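(* Let $E$ be an arbitrary subset of $\mathbb{R}^n$, $N:E\to\mathbb{S}^{n-1}$ a continuous mapping, $X$ a linear subspace of $\mathbb{R}^n$ such that $X=\mathrm{span}(N(E))$, and $P:\mathbb{R}^n\to X$ the orthogonal projection. Then there exists a (possibly unbounded) convex body $W$ of class $C^1$ such that $E\subset\partial W$, $0\in\mathrm{int}(W)$, $N(x)=n_W(x)$ for all $x\in E$, and $X=\mathrm{span}(n_W(\partial W))$, if and only if the following conditions are satisfied: (1) $\langle N(y),x-y\rangle\leq 0$ for all $x,y\in E$. (2) For all sequences $(x_k)_k$, $(z_k)_k$ contained in $E$ with $(P(x_k))_k$ bounded, we have that $$\lim_{k\to\infty}\langle N(z_k),x_k-z_k\rangle=0\implies\lim_{k\to\infty}|N(z_k)-N(x_k)|=0.$$ (3) $0<\inf_{y\in E}\langle N(y),y\rangle$.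
   Context: $\langle\cdot,\cdot\rangle$ and $|\cdot|$ denote the Euclidean inner product and norm on $\mathbb{R}^n$, and $\mathbb{S}^{n-1}$ is the unit sphere. A (possibly unbounded) convex body is a closed convex subset $W$ of $\mathbb{R}^n$ with nonempty interior. If $0\in\mathrm{int}(W)$, the Minkowski functional of $W$ is $\mu_W(x)=\inf\{\lambda>0 : \tfrac1\lambda x\in W\}$, and $W$ is said to be of class $C^1$ if $\mu_W$ is of class $C^1$ on the open set $\mathbb{R}^n\setminus\mu_W^{-1}(0)$. In that case the outer normal to $\partial W$ is $n_W(x)=\nabla\mu_W(x)/|\nabla\mu_W(x)|$ for $x\in\partial W$. An infimum over the empty set is $+\infty$. *)

theory Defs
  imports "HOL-Analysis.Analysis"
begin

text \<open>Convex bodies may be unbounded; the whole space counts as one.\<close>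

definition convex_body :: "'a::euclidean_space set \<Rightarrow> bool" where
  "convex_body W \<longleftrightarrow> closed W \<and> convex W \<and> interior W \<noteq> {}"

text \<open>
  The set below is nonempty and bounded below whenever \<open>0\<close> is an interior point
  of \<open>W\<close>, so the real-valued infimum is then the true one.
\<close>

definition minkowski_functional :: "'a::euclidean_space set \<Rightarrow> 'a \<Rightarrow> real" where
  "minkowski_functional W x = Inf {t. t > 0 \<and> (1 / t) *\<^sub>R x \<in> W}"

text \<open>Meaningful only at points where \<open>f\<close> is differentiable.\<close>

definition gradient :: "('a::euclidean_space \<Rightarrow> real) \<Rightarrow> 'a \<Rightarrow> 'a" where
  "gradient f x = (THE D. GDERIV f x :> D)"

definition C1_on :: "'a::euclidean_space set \<Rightarrow> ('a \<Rightarrow> real) \<Rightarrow> bool" where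
  "C1_on S f \<longleftrightarrow> (\<forall>x\<in>S. f differentiable (at x)) \<and> continuous_on S (gradient f)"

text \<open>The notion is only used for convex bodies with \<open>0\<close> in the interior.\<close>

definition class_C1 :: "'a::euclidean_space set \<Rightarrow> bool" where
  "class_C1 W \<longleftrightarrow> C1_on (UNIV - minkowski_functional W -` {0}) (minkowski_functional W)"

definition outer_normal :: "'a::euclidean_space set \<Rightarrow> 'a \<Rightarrow> 'a" where
  "outer_normal W x =
    gradient (minkowski_functional W) x /\<^sub>R norm (gradient (minkowski_functional W) x)"

definition orthogonal_projection :: "('a::euclidean_space \<Rightarrow> 'a) \<Rightarrow> 'a set \<Rightarrow> bool" where
  "orthogonal_projection P X \<longleftrightarrow> (\<forall>x. P x \<in> X \<and> (\<forall>v\<in>X. orthogonal (x - P x) v))"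

end

theory Submission
  imports Defs
begin

text \<open>
  A support functional of \<open>W\<close> is an element \<open>g\<close> of the polar of \<open>W\<close> with \<open>g \<bullet> x = 1\<close>
  for some \<open>x \<in> W\<close>. The gauge of \<open>W\<close> is \<open>C\<^sup>1\<close> iff every boundary point has exactly
  one support functional, its gradient. If \<open>W\<close> is such a body and its normals span \<open>X\<close>, then \<open>W\<close> is
  invariant under translations orthogonal to \<open>X\<close>, and (2) follows by compactness in \<open>X\<close>
  and uniqueness of support functionals.

  Conversely, let \<open>W\<close> be the closed convex hull of the balls with centre \<open>a\<close> and radius
  \<open>\<rho> a = min \<delta> (d(P a, P(E))\<^sup>2)\<close> that satisfy all the constraints
  \<open>N y \<bullet> x \<le> N y \<bullet> y\<close>. If \<open>g\<close> and \<open>h\<close> support \<open>W\<close> at the same point, then their mean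
  touches one of these balls, and \<open>g\<close> and \<open>h\<close> both support \<open>W\<close> there. If the ball has positive
  radius, this forces \<open>g = h\<close>. Otherwise its centre projects into the closure of \<open>P(E)\<close>,
  and by (2) the centres fill, to first order, the half space orthogonal to a limit of \<open>N\<close>, which again
  forces \<open>g = h\<close>.
\<close>

section \<open>Gauge and polar of a convex neighbourhood of the origin\<close>

text \<open>This is the one-sided polar. For a closed convex \<open>W\<close> around the origin, its
  elements \<open>g\<close> for which \<open>g \<bullet> x\<close> equals the gauge of
  \<open>W\<close> at \<open>x\<close> are the subgradients of the gauge at
  \<open>x\<close>.\<close>

definition polar :: "'a::real_inner set \<Rightarrow> 'a set" where
  "polar W = {g. \<forall>y\<in>W. g \<bullet> y \<le> 1}"

lemma polarI: "(\<And>y. y \<in> W \<Longrightarrow> g \<bullet> y \<le> 1) \<Longrightarrow> g \<in> polar W"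
  by (simp add: polar_def)

lemma polarD: "g \<in> polar W \<Longrightarrow> y \<in> W \<Longrightarrow> g \<bullet> y \<le> 1"
  by (simp add: polar_def)

lemma closed_polar: "closed (polar (W :: 'a::real_inner set))"
proof -
  have "polar W = (\<Inter>y\<in>W. {g. g \<bullet> y \<le> 1})"
    by (auto simp: polar_def)
  moreover have "closed {g. g \<bullet> y \<le> 1}" for y :: 'a
    by (intro closed_Collect_le continuous_intros)
  ultimately show ?thesis
    by (metis closed_INT)
qed

lemma convex_polar: "convex (polar (W :: 'a::real_inner set))"
proof (rule convexI)
  fix g h :: 'a and u v :: real
  assume gh: "g \<in> polar W" "h \<in> polar W" and uv: "0 \<le> u" "0 \<le> v" "u + v = 1"
  show "u *\<^sub>R g + v *\<^sub>R h \<in> polar W"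
  proof (rule polarI)
    fix y assume "y \<in> W"
    then show "(u *\<^sub>R g + v *\<^sub>R h) \<bullet> y \<le> 1"
      using convex_bound_le[of "g \<bullet> y" 1 "h \<bullet> y" u v] gh uv
      by (simp add: inner_add_left polarD)
  qed
qed

text \<open>Half spaces are closed and convex, so the closed convex hull adds no constraint. Support
  functionals of the body can thus be tested on its generating balls.\<close>

lemma polar_hull:
  fixes S :: "'a::euclidean_space set"
  shows "polar (closure (convex hull S)) = polar S"
proof
  show "polar (closure (convex hull S)) \<subseteq> polar S"
    by (meson closure_subset hull_subset polarD polarI subset_iff)
  show "polar S \<subseteq> polar (closure (convex hull S))"
  proof
    fix g assume "g \<in> polar S"
    then have "convex hull S \<subseteq> {y. g \<bullet> y \<le> 1}"
      by (intro hull_minimal convex_halfspace_le) (auto simp: polarD)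
    then have "closure (convex hull S) \<subseteq> {y. g \<bullet> y \<le> 1}"
      by (intro closure_minimal closed_halfspace_le)
    then show "g \<in> polar (closure (convex hull S))"
      by (auto simp: polar_def)
  qed
qed

lemma gradient_eqI:
  assumes "GDERIV f x :> D" shows "gradient f x = D"
  unfolding gradient_def
proof (rule the_equality)
  fix D' assume "GDERIV f x :> D'"
  then have "(\<lambda>h. h \<bullet> D') = (\<lambda>h. h \<bullet> D)"
    using assms has_derivative_unique unfolding gderiv_def by blast
  then show "D' = D"
    by (simp add: fun_eq_iff vector_eq_ldot)
qed fact

section \<open>Elementary properties of the gauge\<close>

locale convex_nbhd =
  fixes W :: "'a::euclidean_space set"
  assumes closed: "closed W" and convex: "convex W" and zero_interior: "0 \<in> interior W"
begin

abbreviation \<mu> :: "'a \<Rightarrow> real" where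
  "\<mu> \<equiv> minkowski_functional W"

lemma zero_mem: "0 \<in> W"
  using zero_interior interior_subset by blast

lemma inner_ball:
  obtains r where "r > 0" "cball 0 r \<subseteq> W"
  using zero_interior by (meson mem_interior_cball)

lemma scaleR_mem: "x \<in> W \<Longrightarrow> 0 \<le> s \<Longrightarrow> s \<le> 1 \<Longrightarrow> s *\<^sub>R x \<in> W"
  using convexD_alt[OF convex zero_mem, of x s] by simp

lemma absorbing: "\<exists>t>0. (1 / t) *\<^sub>R x \<in> W"
proof -
  obtain r where r: "r > 0" "cball 0 r \<subseteq> W"
    by (rule inner_ball)
  have "(1 / ((norm x + 1) / r)) *\<^sub>R x \<in> cball 0 r"
    using r by (simp add: divide_simps add_nonneg_pos)
  moreover have "(norm x + 1) / r > 0"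
    using r by (simp add: add_nonneg_pos)
  ultimately show ?thesis
    using r by blast
qed

lemma bdd: "bdd_below {t. t > 0 \<and> (1 / t) *\<^sub>R x \<in> W}"
  by (rule bdd_belowI[of _ 0]) auto

lemma gauge_le: "t > 0 \<Longrightarrow> (1 / t) *\<^sub>R x \<in> W \<Longrightarrow> \<mu> x \<le> t"
  unfolding minkowski_functional_def by (rule cInf_lower) (use bdd in auto)

lemma gauge_nonneg: "0 \<le> \<mu> x"
  unfolding minkowski_functional_def by (rule cInf_greatest) (use absorbing[of x] in auto)

lemma gauge_lessD:
  assumes "\<mu> x < t" shows "(1 / t) *\<^sub>R x \<in> W"
proof -
  obtain s where s: "s > 0" "(1 / s) *\<^sub>R x \<in> W" "s < t"
    using assms absorbing[of x] cInf_lessD[of "{t. t > 0 \<and> (1 / t) *\<^sub>R x \<in> W}" t]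
    unfolding minkowski_functional_def by auto
  have "(s / t) *\<^sub>R ((1 / s) *\<^sub>R x) \<in> W"
    by (rule scaleR_mem) (use s in auto)
  then show ?thesis
    using s by simp
qed

text \<open>Closedness of \<open>W\<close> admits the limit case: the scalings by slightly larger
  \<open>t\<close> lie in \<open>W\<close> and converge.\<close>

lemma gauge_le_iff:
  assumes "t > 0" shows "\<mu> x \<le> t \<longleftrightarrow> (1 / t) *\<^sub>R x \<in> W"
proof
  assume le: "\<mu> x \<le> t"
  have "(\<lambda>n. (1 / (t + inverse (real (Suc n)))) *\<^sub>R x) \<longlonglongrightarrow> (1 / (t + 0)) *\<^sub>R x"
    (is "?u \<longlonglongrightarrow> _")
    by (intro tendsto_intros LIMSEQ_inverse_real_of_nat) (use assms in auto)
  moreover have "?u n \<in> W" for n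
    using le by (intro gauge_lessD) (simp add: add_strict_increasing2 le_less_trans)
  ultimately show "(1 / t) *\<^sub>R x \<in> W"
    using closed_sequentially[OF closed, of ?u] by simp
qed (use assms gauge_le in blast)

lemma mem_iff: "x \<in> W \<longleftrightarrow> \<mu> x \<le> 1"
  by (simp add: gauge_le_iff)

lemma gauge_subadd: "\<mu> (x + y) \<le> \<mu> x + \<mu> y"
proof (rule field_le_epsilon)
  fix e :: real assume e: "e > 0"
  define s t where st: "s = \<mu> x + e / 2" "t = \<mu> y + e / 2"
  have pos: "s > 0" "t > 0"
    using e gauge_nonneg by (simp_all add: st add_nonneg_pos)
  have "(1 / s) *\<^sub>R x \<in> W" "(1 / t) *\<^sub>R y \<in> W"
    by (rule gauge_lessD, use e in \<open>simp add: st\<close>)+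
  moreover have "s / (s + t) + t / (s + t) = 1"
    using pos by (simp add: add_divide_distrib[symmetric])
  \<comment> \<open>The weights are chosen so that this convex combination is \<open>x + y\<close>
    scaled by \<open>1 / (s + t)\<close>.\<close>
  ultimately have "(s / (s + t)) *\<^sub>R ((1 / s) *\<^sub>R x) + (t / (s + t)) *\<^sub>R ((1 / t) *\<^sub>R y) \<in> W"
    using pos by (intro convexD[OF convex]) auto
  then have "(1 / (s + t)) *\<^sub>R (x + y) \<in> W"
    using pos by (simp add: scaleR_add_right)
  then have "\<mu> (x + y) \<le> s + t"
    using pos by (intro gauge_le) auto
  then show "\<mu> (x + y) \<le> \<mu> x + \<mu> y + e"
    by (simp add: st)
qed

lemma gauge_scaleR:
  assumes "c > 0" shows "\<mu> (c *\<^sub>R x) = c * \<mu> x"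
proof -
  have le: "\<mu> (c *\<^sub>R x) \<le> c * \<mu> x" if "c > 0" for c x
  proof (rule dense_ge)
    fix t assume "c * \<mu> x < t"
    then have "\<mu> x < t / c" "t > 0"
      using that gauge_nonneg[of x] by (auto simp: field_simps intro: le_less_trans[rotated])
    then show "\<mu> (c *\<^sub>R x) \<le> t"
      using gauge_lessD[of x "t / c"] by (intro gauge_le) auto
  qed
  show ?thesis
    using le[OF assms, of x] le[of "1 / c" "c *\<^sub>R x"] assms by (simp add: field_simps)
qed

lemma gauge_le_norm:
  assumes "r > 0" "cball 0 r \<subseteq> W" shows "\<mu> x \<le> norm x / r"
proof (rule dense_ge)
  fix t assume t: "norm x / r < t"
  then have "t > 0"
    using assms by (meson divide_nonneg_pos le_less_trans norm_ge_zero)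
  with t have "(1 / t) *\<^sub>R x \<in> cball 0 r"
    using assms by (simp add: field_simps)
  with \<open>t > 0\<close> show "\<mu> x \<le> t"
    using assms by (intro gauge_le) auto
qed

text \<open>Subadditivity together with the bound \<open>norm x / r\<close> gives the Lipschitz
  constant \<open>1 / r\<close>.\<close>

lemma continuous_on_gauge: "continuous_on S \<mu>"
proof -
  obtain r where r: "r > 0" "cball 0 r \<subseteq> W"
    by (rule inner_ball)
  have *: "\<mu> x - \<mu> y \<le> (1 / r) * dist x y" for x y
    using gauge_subadd[of y "x - y"] gauge_le_norm[OF r, of "x - y"] by (simp add: dist_norm)
  have "(1 / r)-lipschitz_on S \<mu>"
  proof (rule lipschitz_onI)
    show "dist (\<mu> x) (\<mu> y) \<le> 1 / r * dist x y" for x y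
      using *[of x y] *[of y x] by (simp add: dist_real_def abs_le_iff dist_commute)
  qed (use r in simp)
  then show ?thesis
    by (rule lipschitz_on_continuous_on)
qed

lemma interior_eq: "interior W = {x. \<mu> x < 1}"
proof
  have "open {x. \<mu> x < 1}"
    by (intro open_Collect_less continuous_on_gauge continuous_intros)
  then show "{x. \<mu> x < 1} \<subseteq> interior W"
    by (intro interior_maximal) (auto simp: mem_iff)
  show "interior W \<subseteq> {x. \<mu> x < 1}"
  proof clarify
    fix x assume x: "x \<in> interior W"
    then obtain e where e: "e > 0" "cball x e \<subseteq> W"
      by (meson mem_interior_cball)
    \<comment> \<open>A dilation by \<open>c > 1\<close> moves \<open>x\<close> by at most
      \<open>e\<close>; the summand 1 in the denominator covers \<open>x = 0\<close>.\<close>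
    define c where "c = 1 + e / (norm x + 1)"
    have c: "c > 1"
      using e by (simp add: c_def add_nonneg_pos)
    have "e * norm x / (norm x + 1) \<le> e"
      using e by (simp add: divide_le_eq add_nonneg_pos mult_left_mono)
    then have "c *\<^sub>R x \<in> cball x e"
      using e by (simp add: c_def dist_norm scaleR_add_left)
    then have "c * \<mu> x \<le> 1"
      using e c gauge_scaleR[of c x] mem_iff[of "c *\<^sub>R x"] by (simp add: subset_iff)
    then have "\<mu> x \<le> 1 / c"
      using c by (simp add: field_simps)
    also have "1 / c < 1"
      using c by simp
    finally show "\<mu> x < 1" .
  qed
qed

lemma frontier_eq: "frontier W = {x. \<mu> x = 1}"
  using closed by (auto simp: frontier_def interior_eq mem_iff)

section \<open>Support functionals and differentiability of the gauge\<close>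

lemma polar_le_gauge:
  assumes "g \<in> polar W" shows "g \<bullet> y \<le> \<mu> y"
proof (rule dense_ge)
  fix t assume t: "\<mu> y < t"
  then have "t > 0"
    using gauge_nonneg le_less_trans by blast
  with polarD[OF assms gauge_lessD[OF t]] show "g \<bullet> y \<le> t"
    by (simp add: field_simps)
qed

lemma frontierI:
  assumes "x \<in> W" "g \<in> polar W" "g \<bullet> x = 1" shows "x \<in> frontier W"
  using assms polar_le_gauge[of g x] by (auto simp: frontier_eq mem_iff)

text \<open>Testing \<open>g\<close> against itself bounds the square of its norm by
  \<open>\<mu> g\<close>, hence by \<open>norm g / r\<close>.\<close>

lemma polar_norm_le:
  assumes "r > 0" "cball 0 r \<subseteq> W" "g \<in> polar W" shows "norm g \<le> 1 / r"
proof (cases "g = 0")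
  case False
  have "(norm g)\<^sup>2 \<le> norm g / r"
    using polar_le_gauge[of g g] gauge_le_norm[of r g] assms
    by (simp add: power2_norm_eq_inner)
  then show ?thesis
    using False assms by (simp add: power2_eq_square field_simps)
qed (use assms in simp)

lemma polar_attains:
  assumes "\<mu> x > 0" obtains g where "g \<in> polar W" "g \<bullet> x = \<mu> x"
proof -
  define p where "p = (1 / \<mu> x) *\<^sub>R x"
  have p: "p \<in> frontier W"
    using assms gauge_scaleR[of "1 / \<mu> x" x] by (simp add: p_def frontier_eq)
  have ri: "rel_interior W = interior W"
    using zero_interior by (intro rel_interior_nonempty_interior) auto
  obtain a where a: "\<And>y. y \<in> closure W \<Longrightarrow> a \<bullet> p \<le> a \<bullet> y"
    "\<And>y. y \<in> rel_interior W \<Longrightarrow> a \<bullet> p < a \<bullet> y"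
    using supporting_hyperplane_relative_frontier[OF convex, of p] p ri
    by (metis Diff_iff frontier_def)
  \<comment> \<open>Since 0 is interior, \<open>a \<bullet> p\<close> is negative, and dividing by
    it reverses the supporting inequality.\<close>
  have neg: "a \<bullet> p < 0"
    using a(2)[of 0] ri zero_interior by simp
  define g where "g = (1 / (a \<bullet> p)) *\<^sub>R a"
  have "g \<in> polar W"
    using a(1) neg closure_subset[of W] by (intro polarI) (auto simp: g_def divide_le_eq)
  moreover have "g \<bullet> p = 1"
    using neg by (simp add: g_def)
  then have "g \<bullet> x = \<mu> x"
    using assms by (simp add: p_def field_simps)
  ultimately show ?thesis
    by (rule that)
qed

text \<open>The difference of \<open>\<mu>\<close> and \<open>g\<close> has a global minimum at
  \<open>x\<close>, so its derivative vanishes there.\<close>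

lemma polar_eq_gradient:
  assumes "\<mu> differentiable (at x)" "g \<in> polar W" "g \<bullet> x = \<mu> x"
  shows "gradient \<mu> x = g"
proof -
  obtain f' where f': "(\<mu> has_derivative f') (at x)"
    using assms(1) by (auto simp: differentiable_def)
  have "((\<lambda>y. \<mu> y - g \<bullet> y) has_derivative (\<lambda>h. f' h - g \<bullet> h)) (at x)"
    by (intro derivative_intros f')
  moreover have "\<mu> x - g \<bullet> x \<le> \<mu> y - g \<bullet> y" for y
    using polar_le_gauge[OF assms(2), of y] assms(3) by simp
  ultimately have "(\<lambda>h. f' h - g \<bullet> h) = (\<lambda>h. 0)"
    by (intro has_derivative_local_min) (auto intro: always_eventually)
  then have "f' = (\<lambda>h. h \<bullet> g)"
    by (auto simp: fun_eq_iff inner_commute)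
  with f' show ?thesis
    by (intro gradient_eqI) (simp add: gderiv_def)
qed

lemma class_C1_polar_unique:
  assumes "class_C1 W" "x \<in> frontier W" "g \<in> polar W" "g \<bullet> x = 1"
  shows "gradient \<mu> x = g"
proof -
  have "\<mu> x = 1"
    using assms frontier_eq by auto
  moreover from this have "\<mu> differentiable (at x)"
    using assms(1) by (auto simp: class_C1_def C1_on_def)
  ultimately show ?thesis
    using assms by (intro polar_eq_gradient) auto
qed

text \<open>The gauge is convex, so a unique subgradient at \<open>x\<close> is a derivative there; its graph
  is closed and it stays bounded, hence it depends continuously on \<open>x\<close>.\<close>

lemma class_C1I:
  assumes uniq: "\<And>x g h. x \<in> frontier W \<Longrightarrow> g \<in> polar W \<Longrightarrow> h \<in> polar W
      \<Longrightarrow> g \<bullet> x = 1 \<Longrightarrow> h \<bullet> x = 1 \<Longrightarrow> g = h"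
  shows "class_C1 W"
proof -
  define U where "U = UNIV - \<mu> -` {0}"
  have U: "x \<in> U \<longleftrightarrow> \<mu> x > 0" for x
    using gauge_nonneg[of x] by (auto simp: U_def)
  have "open {x. 0 < \<mu> x}"
    by (intro open_Collect_less continuous_on_gauge continuous_intros)
  then have open_U: "open U"
    using U by (metis Collect_cong Collect_mem_eq)
  \<comment> \<open>Homogeneity carries uniqueness from the boundary to every point of positive
    gauge.\<close>
  have uniq': "g = h"
    if "\<mu> x > 0" "g \<in> polar W" "h \<in> polar W" "g \<bullet> x = \<mu> x" "h \<bullet> x = \<mu> x" for x g h
  proof (rule uniq[of "(1 / \<mu> x) *\<^sub>R x"])
    show "(1 / \<mu> x) *\<^sub>R x \<in> frontier W"
      using that gauge_scaleR[of "1 / \<mu> x" x] by (simp add: frontier_eq)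
  qed (use that in auto)
  define G where "G x = (SOME g. g \<in> polar W \<and> g \<bullet> x = \<mu> x)" for x
  have G: "G x \<in> polar W" "G x \<bullet> x = \<mu> x" if "x \<in> U" for x
    using someI_ex[of "\<lambda>g. g \<in> polar W \<and> g \<bullet> x = \<mu> x"] polar_attains[of x] U that
    unfolding G_def by blast+
  obtain r where r: "r > 0" "cball 0 r \<subseteq> W"
    by (rule inner_ball)
  have G_bd: "G \<in> U \<rightarrow> cball 0 (1 / r)"
    using G polar_norm_le[OF r] by auto
  have cont: "continuous_on U G"
  proof (subst continuous_closed_graph_eq[OF compact_cball G_bd])
    \<comment> \<open>By uniqueness the graph of the selection \<open>G\<close> contains all pairs
      satisfying the closed conditions on the right.\<close>
    have "(\<lambda>x. (x, G x)) ` U =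
        (U \<times> cball 0 (1 / r)) \<inter> ({q. snd q \<bullet> fst q = \<mu> (fst q)} \<inter> (UNIV \<times> polar W))"
      using G G_bd uniq' U by (auto simp: image_iff)
    moreover have "closed ({q. snd q \<bullet> fst q = \<mu> (fst q)} \<inter> (UNIV \<times> polar W))"
      by (intro closed_Int closed_Times closed_polar closed_UNIV closed_Collect_eq
          continuous_intros continuous_on_compose2[OF continuous_on_gauge]) auto
    ultimately show "closedin (top_of_set (U \<times> cball 0 (1 / r))) ((\<lambda>x. (x, G x)) ` U)"
      by (simp only: closedin_closed_Int)
  qed
  have deriv: "GDERIV \<mu> x :> G x" if x: "x \<in> U" for x
    unfolding gderiv_def has_derivative_at_within
  proof (intro conjI)
    show "bounded_linear (\<lambda>h. h \<bullet> G x)"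
      by (rule bounded_linear_inner_left)
    have "((\<lambda>y. norm (G y - G x)) \<longlongrightarrow> norm (G x - G x)) (at x)"
      using cont x open_U
      by (intro tendsto_intros) (simp add: continuous_on_eq_continuous_at isContD)
    then have lim: "((\<lambda>y. norm (G y - G x)) \<longlongrightarrow> 0) (at x)"
      by simp
    show "((\<lambda>y. (\<mu> y - \<mu> x - (y - x) \<bullet> G x) /\<^sub>R norm (y - x)) \<longlongrightarrow> 0) (at x)"
    proof (rule Lim_null_comparison[OF _ lim])
      have "eventually (\<lambda>y. y \<in> U) (at x)"
        using open_U x by (rule eventually_at_in_open')
      then show "eventually (\<lambda>y. norm ((\<mu> y - \<mu> x - (y - x) \<bullet> G x) /\<^sub>R norm (y - x))
          \<le> norm (G y - G x)) (at x)"
      proof eventually_elim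
        case (elim y)
        have "G x \<bullet> y \<le> \<mu> y" "G y \<bullet> x \<le> \<mu> x"
          using G elim x polar_le_gauge by auto
        \<comment> \<open>The subgradient at \<open>x\<close> makes the first-order remainder
          nonnegative, and the one at \<open>y\<close> bounds it from above.\<close>
        then have "0 \<le> \<mu> y - \<mu> x - (y - x) \<bullet> G x"
          "\<mu> y - \<mu> x - (y - x) \<bullet> G x \<le> (G y - G x) \<bullet> (y - x)"
          using G(2)[OF x] G(2)[OF elim] by (simp_all add: inner_diff inner_commute)
        then have "\<bar>\<mu> y - \<mu> x - (y - x) \<bullet> G x\<bar> \<le> norm (G y - G x) * norm (y - x)"
          using norm_cauchy_schwarz[of "G y - G x" "y - x"] by linarith
        then show ?case
          by (cases "y = x") (simp_all add: field_simps)
      qed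
    qed
  qed
  have "\<mu> differentiable (at x)" if "x \<in> U" for x
    using deriv[OF that] by (auto simp: gderiv_def differentiable_def)
  moreover have "continuous_on U (gradient \<mu>)"
    using cont by (rule continuous_on_eq) (simp add: gradient_eqI[OF deriv])
  ultimately show ?thesis
    by (auto simp: class_C1_def C1_on_def U_def)
qed

lemma class_C1_gradient:
  assumes "class_C1 W" "x \<in> frontier W"
  shows "gradient \<mu> x \<in> polar W" "gradient \<mu> x \<bullet> x = 1"
proof -
  obtain g where "g \<in> polar W" "g \<bullet> x = 1"
    using polar_attains[of x] assms(2) frontier_eq by auto
  then show "gradient \<mu> x \<in> polar W" "gradient \<mu> x \<bullet> x = 1"
    using class_C1_polar_unique[OF assms] by auto
qed

end

section \<open>Orthogonal projections\<close>

locale ortho_proj =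
  fixes P :: "'a::euclidean_space \<Rightarrow> 'a" and X :: "'a set"
  assumes subspace: "subspace X" and proj: "orthogonal_projection P X"
begin

lemma proj_mem: "P x \<in> X"
  using proj by (simp add: orthogonal_projection_def)

lemma inner_proj:
  assumes "g \<in> X" shows "g \<bullet> P x = g \<bullet> x"
proof -
  have "(x - P x) \<bullet> g = 0"
    using proj assms by (auto simp: orthogonal_projection_def orthogonal_def)
  then show ?thesis
    by (simp add: inner_diff inner_commute)
qed

lemma proj_eqI:
  assumes "y \<in> X" "\<And>v. v \<in> X \<Longrightarrow> v \<bullet> y = v \<bullet> x" shows "P x = y"
proof -
  have "P x - y \<in> X"
    using assms(1) proj_mem subspace by (simp add: subspace_diff)
  then have "(P x - y) \<bullet> (P x - y) = 0"
    using assms(2)[of "P x - y"] inner_proj[of "P x - y" x] by (simp add: inner_diff_right)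
  then show ?thesis
    by simp
qed

lemma proj_id: "x \<in> X \<Longrightarrow> P x = x"
  by (rule proj_eqI) auto

lemma linear_proj: "linear P"
proof (rule linearI)
  show "P (x + y) = P x + P y" for x y
    by (rule proj_eqI) (auto simp: subspace subspace_add proj_mem inner_add_right inner_proj)
  show "P (c *\<^sub>R x) = c *\<^sub>R P x" for c x
    by (rule proj_eqI) (auto simp: subspace subspace_scale proj_mem inner_proj)
qed

lemma norm_proj_le: "norm (P x) \<le> norm x"
proof (cases "P x = 0")
  case False
  have "norm (P x) * norm (P x) \<le> norm (P x) * norm x"
    using inner_proj[OF proj_mem[of x], of x] norm_cauchy_schwarz[of "P x" x]
    by (simp add: power2_norm_eq_inner[symmetric] power2_eq_square)
  then show ?thesis
    using False by simp
qed simp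

lemma dist_proj_le: "dist (P x) (P y) \<le> dist x y"
  using norm_proj_le[of "x - y"] by (simp add: dist_norm linear_diff[OF linear_proj])

text \<open>The set contains full lines in all directions orthogonal to \<open>X\<close>; a
  functional bounded above on a line is constant along it.\<close>

lemma polar_subset:
  assumes "w \<in> W" and inv: "\<And>x v. x \<in> W \<Longrightarrow> P v = 0 \<Longrightarrow> x + v \<in> W"
  shows "polar W \<subseteq> X"
proof
  fix g assume g: "g \<in> polar W"
  define v where "v = g - P g"
  have Pv: "P v = 0"
    by (simp add: v_def linear_diff[OF linear_proj] proj_id proj_mem)
  have gv: "g \<bullet> v = v \<bullet> v"
    using inner_proj[OF proj_mem[of g], of v] Pv by (simp add: v_def inner_diff_left)
  have le: "g \<bullet> w + t * (v \<bullet> v) \<le> 1" for t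
    using polarD[OF g inv[OF assms(1), of "t *\<^sub>R v"]] Pv gv
    by (simp add: linear_scale[OF linear_proj] inner_add_right)
  have "v = 0"
  proof (rule ccontr)
    assume "v \<noteq> 0"
    \<comment> \<open>This multiple of \<open>v\<close> would raise the value of \<open>g\<close> to
      2.\<close>
    then show False
      using le[of "(2 - g \<bullet> w) / (v \<bullet> v)"] by simp
  qed
  then show "g \<in> X"
    using proj_mem[of g] by (simp add: v_def)
qed

end

section \<open>Necessity\<close>

locale C1_body = convex_nbhd W + ortho_proj P X
  for W X :: "'a::euclidean_space set" and P +
  assumes C1: "class_C1 W" and span_normals: "X = span (outer_normal W ` frontier W)"
begin

lemma gradient_mem:
  assumes "x \<in> frontier W" shows "gradient \<mu> x \<in> X"
proof -
  have "norm (gradient \<mu> x) *\<^sub>R outer_normal W x \<in> X"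
    unfolding span_normals using assms by (intro span_scale span_base) auto
  moreover have "gradient \<mu> x \<noteq> 0"
    using class_C1_gradient(2)[OF C1 assms] by auto
  ultimately show ?thesis
    by (simp add: outer_normal_def)
qed

text \<open>A support functional at a boundary point is the gradient there, hence lies in
  \<open>X\<close> and does not see components orthogonal to \<open>X\<close>.\<close>

lemma gauge_proj: "\<mu> (P x) = \<mu> x"
proof -
  have le: "\<mu> y \<le> \<mu> x" if "P x = P y" for x y
  proof (cases "\<mu> y > 0")
    case True
    then obtain g where g: "g \<in> polar W" "g \<bullet> y = \<mu> y"
      by (rule polar_attains)
    have "(1 / \<mu> y) *\<^sub>R y \<in> frontier W"
      using True gauge_scaleR[of "1 / \<mu> y" y] by (simp add: frontier_eq)
    then have "g \<in> X"
      using class_C1_polar_unique[OF C1, of "(1 / \<mu> y) *\<^sub>R y" g] gradient_mem g True by auto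
    then have "g \<bullet> x = g \<bullet> y"
      using inner_proj that by metis
    then show ?thesis
      using g polar_le_gauge[of g x] by simp
  qed (use gauge_nonneg[of x] in linarith)
  have "P (P x) = P x"
    by (simp add: proj_id proj_mem)
  then show ?thesis
    using le[of x "P x"] le[of "P x" x] by simp
qed

lemma outer_normal_le:
  assumes "x \<in> W" "y \<in> frontier W" shows "outer_normal W y \<bullet> (x - y) \<le> 0"
proof -
  have "gradient \<mu> y \<bullet> x - 1 \<le> 0"
    using class_C1_gradient(1)[OF C1 assms(2)] assms(1) by (simp add: polarD)
  then have "inverse (norm (gradient \<mu> y)) * (gradient \<mu> y \<bullet> x - 1) \<le> 0"
    by (simp add: mult_le_0_iff)
  then show ?thesis
    using class_C1_gradient(2)[OF C1 assms(2)]
    by (simp add: outer_normal_def inner_diff_right right_diff_distrib)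
qed

text \<open>The inner product is the reciprocal of the gradient norm, which is at most
  \<open>1 / r\<close> for an inner ball of radius \<open>r\<close>. This gives (3).\<close>

lemma outer_normal_inner_ge:
  obtains r where "r > 0" "\<And>y. y \<in> frontier W \<Longrightarrow> r \<le> outer_normal W y \<bullet> y"
proof -
  obtain r where r: "r > 0" "cball 0 r \<subseteq> W"
    by (rule inner_ball)
  have "r \<le> outer_normal W y \<bullet> y" if "y \<in> frontier W" for y
  proof -
    note g = class_C1_gradient[OF C1 that]
    have "norm (gradient \<mu> y) > 0"
      using g(2) by auto
    then show ?thesis
      using polar_norm_le[OF r g(1)] r g(2) by (simp add: outer_normal_def field_simps)
  qed
  with r show ?thesis
    by (intro that)
qed

text \<open>By compactness one may pass to the limit in the bounded sequences \<open>P (x k)\<close> and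
  of gradients at \<open>x k\<close> and \<open>z k\<close>; both limit gradients support \<open>W\<close> at \<open>lim P (x k)\<close>.\<close>

lemma outer_normal_tendsto:
  assumes x: "\<And>k. x k \<in> frontier W" and z: "\<And>k. z k \<in> frontier W"
    and bdd: "bounded (range (\<lambda>k. P (x k)))"
    and lim: "(\<lambda>k. outer_normal W (z k) \<bullet> (x k - z k)) \<longlonglongrightarrow> 0"
  shows "(\<lambda>k. norm (outer_normal W (z k) - outer_normal W (x k))) \<longlonglongrightarrow> 0"
proof (rule ccontr)
  assume "\<not> ?thesis"
  then obtain e where e: "e > 0"
    and "\<not> (\<exists>n. \<forall>k\<ge>n. norm (outer_normal W (z k) - outer_normal W (x k)) < e)"
    unfolding LIMSEQ_iff by auto
  then have "\<exists>\<^sub>\<infinity>k. e \<le> norm (outer_normal W (z k) - outer_normal W (x k))"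
    unfolding INFM_nat_le by (meson not_le)
  then obtain s :: "nat \<Rightarrow> nat" where s: "strict_mono s"
    "\<And>k. e \<le> norm (outer_normal W (z (s k)) - outer_normal W (x (s k)))"
    using infinite_enumerate[of "{k. e \<le> norm (outer_normal W (z k) - outer_normal W (x k))}"]
    unfolding INFM_iff_infinite by auto
  \<comment> \<open>Unnormalised gradients are used because they lie in the closed set
    \<open>polar W\<close> and have value 1 at their base points.\<close>
  define G where "G = gradient \<mu>"
  have G: "G y \<in> polar W" "G y \<bullet> y = 1" "G y \<in> X" if "y \<in> frontier W" for y
    using class_C1_gradient[OF C1 that] gradient_mem[OF that] by (auto simp: G_def)
  obtain r where r: "r > 0" "cball 0 r \<subseteq> W"
    by (rule inner_ball)
  have bddG: "bounded (G ` frontier W)"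
    unfolding bounded_iff using G(1) polar_norm_le[OF r] by blast
  define F where "F k = (P (x k), G (x k), G (z k))" for k
  have "range (F \<circ> s) \<subseteq> range (\<lambda>k. P (x k)) \<times> G ` frontier W \<times> G ` frontier W"
    using x z by (auto simp: F_def)
  moreover have "bounded (range (\<lambda>k. P (x k)) \<times> G ` frontier W \<times> G ` frontier W)"
    by (intro bounded_Times bdd bddG)
  ultimately have "bounded (range (F \<circ> s))"
    using bounded_subset by blast
  then obtain l t where t: "strict_mono t" "((F \<circ> s) \<circ> t) \<longlonglongrightarrow> l"
    using bounded_imp_convergent_subsequence by blast
  obtain x0 g h where l: "l = (x0, g, h)"
    by (cases l)
  define u where "u = s \<circ> t"
  have u: "strict_mono u"
    using s(1) t(1) by (simp add: u_def strict_mono_o)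
  have "(\<lambda>k. F (u k)) \<longlonglongrightarrow> (x0, g, h)"
    using t(2) by (simp add: l u_def o_def)
  from tendsto_fst[OF this] tendsto_fst[OF tendsto_snd[OF this]]
    tendsto_snd[OF tendsto_snd[OF this]]
  have lims: "(\<lambda>k. P (x (u k))) \<longlonglongrightarrow> x0" "(\<lambda>k. G (x (u k))) \<longlonglongrightarrow> g" "(\<lambda>k. G (z (u k))) \<longlonglongrightarrow> h"
    by (simp_all add: F_def)
  have gh: "g \<in> polar W" "h \<in> polar W"
    using closed_sequentially[OF closed_polar _ lims(2)] closed_sequentially[OF closed_polar _ lims(3)]
      G(1) x z by blast+
  \<comment> \<open>The projected points stay on the boundary, so their limit does too, although
    \<open>x\<close> itself may be unbounded.\<close>
  have "\<mu> (P (x (u k))) = 1" for k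
    using x[of "u k"] by (simp add: gauge_proj frontier_eq)
  then have "P (x (u k)) \<in> frontier W" for k
    by (simp add: frontier_eq)
  then have x0: "x0 \<in> frontier W"
    using closed_sequentially[OF frontier_closed _ lims(1)] by blast
  have gx: "(\<lambda>k. G (x (u k)) \<bullet> P (x (u k))) \<longlonglongrightarrow> g \<bullet> x0"
    by (intro tendsto_intros lims)
  have "G (x (u k)) \<bullet> P (x (u k)) = 1" for k
    using G(2,3)[OF x] by (simp add: inner_proj)
  with gx have g1: "g \<bullet> x0 = 1"
    by (simp add: LIMSEQ_const_iff)
  have "(\<lambda>k. outer_normal W (z (u k)) \<bullet> (x (u k) - z (u k))) \<longlonglongrightarrow> 0"
    using LIMSEQ_subseq_LIMSEQ[OF lim u] by (simp add: o_def)
  \<comment> \<open>Multiplying by the gradient norm undoes the normalisation; adding 1 cancels the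
    value of the gradient at \<open>z (u k)\<close>.\<close>
  from tendsto_add[OF tendsto_mult[OF tendsto_norm[OF lims(3)] this] tendsto_const[of 1]]
  have "(\<lambda>k. norm (G (z (u k))) * (outer_normal W (z (u k)) \<bullet> (x (u k) - z (u k))) + 1) \<longlonglongrightarrow> 1"
    by simp
  moreover have "norm (G (z (u k))) * (outer_normal W (z (u k)) \<bullet> (x (u k) - z (u k))) + 1
      = G (z (u k)) \<bullet> P (x (u k))" for k
  proof -
    have "norm (G (z (u k))) \<noteq> 0"
      using G(2)[OF z, of "u k"] by auto
    then show ?thesis
      using G(2,3)[OF z, of "u k"]
      by (simp add: outer_normal_def G_def[symmetric] inner_proj inner_diff_right field_simps)
  qed
  ultimately have "(\<lambda>k. G (z (u k)) \<bullet> P (x (u k))) \<longlonglongrightarrow> 1"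
    by simp
  moreover have "(\<lambda>k. G (z (u k)) \<bullet> P (x (u k))) \<longlonglongrightarrow> h \<bullet> x0"
    by (intro tendsto_intros lims)
  ultimately have "h \<bullet> x0 = 1"
    using LIMSEQ_unique by blast
  then have "g = h"
    using class_C1_polar_unique[OF C1 x0] gh g1 by metis
  have "g \<noteq> 0"
    using g1 by auto
  have "(\<lambda>k. norm (G (z (u k)) /\<^sub>R norm (G (z (u k))) - G (x (u k)) /\<^sub>R norm (G (x (u k)))))
      \<longlonglongrightarrow> norm (h /\<^sub>R norm h - g /\<^sub>R norm g)"
    by (intro tendsto_intros lims) (use \<open>g \<noteq> 0\<close> \<open>g = h\<close> in auto)
  then have "(\<lambda>k. norm (outer_normal W (z (u k)) - outer_normal W (x (u k)))) \<longlonglongrightarrow> 0"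
    by (simp add: outer_normal_def G_def \<open>g = h\<close>)
  then have "e \<le> 0"
    by (rule tendsto_lowerbound[OF _ always_eventually]) (use s in \<open>auto simp: u_def\<close>)
  with e show False
    by simp
qed

end

section \<open>Sufficiency\<close>

text \<open>Upper bounds on all \<open>b \<bullet> x\<close> and a lower bound on their sum bound
  each of them on both sides. These numbers control \<open>x\<close>, since the map \<open>L\<close>
  is injective on \<open>span B\<close>.\<close>

lemma coercive_bounded:
  fixes B S :: "'a::euclidean_space set"
  assumes "finite B" "S \<subseteq> span B"
    and upper: "\<And>b x. b \<in> B \<Longrightarrow> x \<in> S \<Longrightarrow> b \<bullet> x \<le> c b"
    and lower: "\<And>x. x \<in> S \<Longrightarrow> m \<le> \<Sum>B \<bullet> x"
  shows "bounded S"
proof -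
  define L where "L x = (\<Sum>b\<in>B. (b \<bullet> x) *\<^sub>R b)" for x
  have "bounded_linear L"
    unfolding L_def
    by (intro bounded_linear_sum bounded_linear_scaleR_const bounded_linear_inner_right)
  moreover have "x = 0" if "x \<in> span B" "L x = 0" for x
  proof -
    have "(\<Sum>b\<in>B. (b \<bullet> x) * (b \<bullet> x)) = L x \<bullet> x"
      by (simp add: L_def inner_sum_left)
    then have "\<forall>b\<in>B. (b \<bullet> x) * (b \<bullet> x) = 0"
      using that(2) assms(1) sum_nonneg_eq_0_iff[of B "\<lambda>b. (b \<bullet> x) * (b \<bullet> x)"] by simp
    then have "orthogonal x b" if "b \<in> B" for b
      using that by (simp add: orthogonal_def inner_commute)
    then show "x = 0"
      using orthogonal_to_span[OF that(1), of x] orthogonal_self by blast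
  qed
  ultimately obtain e where e: "e > 0" "\<And>x. x \<in> span B \<Longrightarrow> e * norm x \<le> norm (L x)"
    using injective_imp_isometric[OF closed_span subspace_span, of L B] by metis
  define C where "C = \<bar>m\<bar> + (\<Sum>b\<in>B. \<bar>c b\<bar>)"
  have C: "\<bar>b \<bullet> x\<bar> \<le> C" if b: "b \<in> B" and x: "x \<in> S" for b x
  proof -
    have "\<Sum>B \<bullet> x = b \<bullet> x + (\<Sum>b'\<in>B - {b}. b' \<bullet> x)"
      using sum.remove[OF assms(1) b, of "\<lambda>b. b \<bullet> x"] by (simp add: inner_sum_left)
    also have "(\<Sum>b'\<in>B - {b}. b' \<bullet> x) \<le> (\<Sum>b'\<in>B - {b}. \<bar>c b'\<bar>)"
      using upper x by (intro sum_mono order_trans[OF _ abs_ge_self]) auto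
    finally have "m \<le> b \<bullet> x + (\<Sum>b'\<in>B - {b}. \<bar>c b'\<bar>)"
      using lower[OF x] by simp
    moreover have "(\<Sum>b'\<in>B. \<bar>c b'\<bar>) = \<bar>c b\<bar> + (\<Sum>b'\<in>B - {b}. \<bar>c b'\<bar>)"
      using assms(1) b by (simp add: sum.remove)
    moreover have "0 \<le> (\<Sum>b'\<in>B - {b}. \<bar>c b'\<bar>)"
      by (simp add: sum_nonneg)
    ultimately show ?thesis
      using upper[OF b x] unfolding C_def by linarith
  qed
  have "norm x \<le> (\<Sum>b\<in>B. C * norm b) / e" if x: "x \<in> S" for x
  proof -
    have "norm (L x) \<le> (\<Sum>b\<in>B. norm ((b \<bullet> x) *\<^sub>R b))"
      unfolding L_def by (rule norm_sum)
    also have "\<dots> \<le> (\<Sum>b\<in>B. C * norm b)"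
      using C x by (intro sum_mono) (simp add: mult_right_mono)
    finally show ?thesis
      using e(2)[of x] assms(2) x e(1) by (auto simp: field_simps)
  qed
  then show ?thesis
    unfolding bounded_iff by blast
qed

lemma scaled_eq:
  fixes g :: "'a::real_inner"
  assumes "g = c *\<^sub>R u" "h = d *\<^sub>R u" "g \<bullet> x = 1" "h \<bullet> x = 1"
  shows "g = h"
proof -
  have "c * (u \<bullet> x) = 1" "d * (u \<bullet> x) = 1"
    using assms by auto
  then have "c = d"
    by (metis mult_cancel_right mult_zero_right zero_neq_one)
  with assms show ?thesis
    by simp
qed

text \<open>Comparison with the point of the ball farthest in direction \<open>g\<close> forces
  equality in the Cauchy-Schwarz inequality for \<open>g\<close> and \<open>x - a\<close>.\<close>

lemma max_cball_direction:
  fixes a x g :: "'a::real_inner"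
  assumes "r > 0" "dist a x \<le> r" and le: "\<And>y. dist a y \<le> r \<Longrightarrow> g \<bullet> y \<le> g \<bullet> x"
  shows "g = (norm g / r) *\<^sub>R (x - a)"
proof (cases "g = 0")
  case False
  define y where "y = a + (r / norm g) *\<^sub>R g"
  have "dist a y \<le> r"
    using assms(1) False by (simp add: y_def dist_norm)
  from le[OF this] have "norm g * r \<le> g \<bullet> (x - a)"
    using False by (simp add: y_def inner_add_right inner_diff_right power2_norm_eq_inner[symmetric] power2_eq_square mult.commute)
  moreover have nx: "norm (x - a) \<le> r"
    using assms(2) by (simp add: dist_norm norm_minus_commute)
  have "g \<bullet> (x - a) \<le> norm g * norm (x - a)"
    by (rule norm_cauchy_schwarz)
  moreover have "norm g * norm (x - a) \<le> norm g * r"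
    using nx by (simp add: mult_left_mono)
  ultimately have "g \<bullet> (x - a) = norm g * norm (x - a)" "norm g * norm (x - a) = norm g * r"
    by linarith+
  moreover from this(2) have "norm (x - a) = r"
    using False by simp
  ultimately have "g \<bullet> (x - a) = norm g * norm (x - a)" "norm (x - a) = r"
    by simp_all
  then have "r *\<^sub>R g = norm g *\<^sub>R (x - a)"
    by (metis norm_cauchy_schwarz_eq)
  then have "(1 / r) *\<^sub>R (r *\<^sub>R g) = (norm g / r) *\<^sub>R (x - a)"
    by simp
  then show ?thesis
    using assms(1) by simp
qed simp

lemma halfspace_direction:
  fixes g \<nu> :: "'a::real_inner"
  assumes \<nu>: "norm \<nu> = 1" and le: "\<And>h. \<nu> \<bullet> h < 0 \<Longrightarrow> g \<bullet> h \<le> 0"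
  shows "g = (g \<bullet> \<nu>) *\<^sub>R \<nu>"
proof -
  define w where "w = g - (g \<bullet> \<nu>) *\<^sub>R \<nu>"
  have \<nu>\<nu>: "\<nu> \<bullet> \<nu> = 1"
    using \<nu> by (simp add: norm_eq_1)
  have \<nu>w: "\<nu> \<bullet> w = 0"
    using \<nu>\<nu> by (simp add: w_def inner_diff_right inner_commute)
  have gw: "g \<bullet> w = w \<bullet> w"
    using \<nu>w by (simp add: w_def inner_diff_left)
  \<comment> \<open>Every \<open>t *\<^sub>R w - \<nu>\<close> lies in the open half space; large
    \<open>t\<close> then rules out a nonzero \<open>w\<close>.\<close>
  have le: "t * (w \<bullet> w) \<le> g \<bullet> \<nu>" for t
    using le[of "t *\<^sub>R w - \<nu>"] \<nu>w \<nu>\<nu> gw by (simp add: inner_diff_right)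
  have "w = 0"
  proof (rule ccontr)
    assume "w \<noteq> 0"
    then show False
      using le[of "(g \<bullet> \<nu> + 1) / (w \<bullet> w)"] by simp
  qed
  then show ?thesis
    by (simp add: w_def)
qed

text \<open>Conditions (1) to (3) for nonempty \<open>E\<close>. The real number
  \<open>\<delta>\<close> witnesses (3) and also caps the radii of the balls.\<close>

locale normal_field = ortho_proj P X for P :: "'a::euclidean_space \<Rightarrow> 'a" and X +
  fixes E :: "'a set" and N :: "'a \<Rightarrow> 'a" and \<delta> :: real
  assumes nonempty: "E \<noteq> {}"
    and norm_N: "\<And>y. y \<in> E \<Longrightarrow> norm (N y) = 1"
    and span_N: "X = span (N ` E)"
    and monotone: "\<And>x y. x \<in> E \<Longrightarrow> y \<in> E \<Longrightarrow> N y \<bullet> (x - y) \<le> 0"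
    and separation: "\<And>x z. range x \<subseteq> E \<Longrightarrow> range z \<subseteq> E \<Longrightarrow> bounded (range (\<lambda>k::nat. P (x k)))
      \<Longrightarrow> (\<lambda>k. N (z k) \<bullet> (x k - z k)) \<longlonglongrightarrow> 0 \<Longrightarrow> (\<lambda>k. norm (N (z k) - N (x k))) \<longlonglongrightarrow> 0"
    and \<delta>_pos: "\<delta> > 0" and \<delta>_le: "\<And>y. y \<in> E \<Longrightarrow> \<delta> \<le> N y \<bullet> y"
begin

lemma N_mem: "y \<in> E \<Longrightarrow> N y \<in> X"
  unfolding span_N by (intro span_base) auto

text \<open>A radius vanishing to second order at \<open>P ` E\<close>: at the points of \<open>E\<close> balls of this
  size leave room for all directions in the open half space prescribed by \<open>N\<close>.\<close>

definition \<rho> :: "'a \<Rightarrow> real" where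
  "\<rho> a = min \<delta> ((infdist (P a) (P ` E))\<^sup>2)"

text \<open>As \<open>N y\<close> is a unit vector, the inequality puts the whole ball of radius
  \<open>\<rho> a\<close> about \<open>a\<close> into the half space bounded by the prescribed
  tangent hyperplane at \<open>y\<close>.\<close>

definition centres :: "'a set" where
  "centres = {a. \<forall>y\<in>E. N y \<bullet> a + \<rho> a \<le> N y \<bullet> y}"

definition balls :: "'a set" where
  "balls = (\<Union>a\<in>centres. cball a (\<rho> a))"

definition body :: "'a set" where
  "body = closure (convex hull balls)"

lemma \<rho>_nonneg: "0 \<le> \<rho> a"
  using \<delta>_pos by (simp add: \<rho>_def)

lemma \<rho>_le: "\<rho> a \<le> \<delta>"
  by (simp add: \<rho>_def)

lemma \<rho>_proj: "\<rho> (P a) = \<rho> a"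
  by (simp add: \<rho>_def proj_id proj_mem)

section \<open>The generating balls and their constraints\<close>

lemma continuous_on_\<rho>: "continuous_on S \<rho>"
proof -
  have "continuous_on S P"
    by (rule linear_continuous_on) (simp add: linear_proj linear_conv_bounded_linear[symmetric])
  then show ?thesis
    unfolding \<rho>_def[abs_def] by (intro continuous_intros)
qed

lemma proj_centres: "a \<in> centres \<Longrightarrow> P a \<in> centres"
  by (simp add: centres_def \<rho>_proj inner_proj N_mem)

lemma closed_centres: "closed centres"
proof -
  have "centres = (\<Inter>y\<in>E. {a. N y \<bullet> a + \<rho> a \<le> N y \<bullet> y})"
    by (auto simp: centres_def)
  moreover have "closed {a. N y \<bullet> a + \<rho> a \<le> N y \<bullet> y}" for y
    by (intro closed_Collect_le continuous_intros continuous_on_\<rho>)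
  ultimately show ?thesis
    by (simp add: closed_INT)
qed

lemma centres_subset_balls: "centres \<subseteq> balls"
  using \<rho>_nonneg by (force simp: balls_def)

text \<open>The radius vanishes on \<open>E\<close>, where the constraints on centres reduce to
  (1).\<close>

lemma subset_balls: "E \<subseteq> balls"
proof -
  have "\<rho> x = 0" if "x \<in> E" for x
    using that \<delta>_pos by (simp add: \<rho>_def min_def)
  then have "E \<subseteq> centres"
    using monotone by (auto simp: centres_def inner_diff_right)
  then show ?thesis
    using centres_subset_balls by blast
qed

lemma balls_le:
  assumes "x \<in> balls" "y \<in> E" shows "N y \<bullet> x \<le> N y \<bullet> y"
proof -
  obtain a where a: "a \<in> centres" "norm (x - a) \<le> \<rho> a"
    using assms(1) by (auto simp: balls_def dist_norm norm_minus_commute)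
  have "N y \<bullet> (x - a) \<le> norm (N y) * norm (x - a)"
    by (rule norm_cauchy_schwarz)
  then show ?thesis
    using a assms(2) by (auto simp: centres_def norm_N inner_diff_right)
qed

text \<open>By (3) the origin has distance at least \<open>\<delta>\<close> from the projection of
  \<open>E\<close>, so its radius is positive; the cap \<open>\<delta>\<close> on the radius makes
  it a centre.\<close>

lemma zero_interior_balls: "0 \<in> interior balls"
proof -
  have "\<delta> \<le> dist (P 0) (P y)" if y: "y \<in> E" for y
  proof -
    have "\<delta> \<le> N y \<bullet> P y"
      using \<delta>_le y by (simp add: inner_proj N_mem)
    also have "\<dots> \<le> norm (P y)"
      using norm_cauchy_schwarz[of "N y" "P y"] norm_N[OF y] by simp
    finally show ?thesis
      by (simp add: linear_0[OF linear_proj])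
  qed
  then have "\<delta> \<le> infdist (P 0) (P ` E)"
    using nonempty by (auto simp: infdist_def intro!: cINF_greatest)
  then have "0 < \<rho> 0"
    using \<delta>_pos by (simp add: \<rho>_def less_le_trans)
  moreover have "0 \<in> centres"
    using order_trans[OF \<rho>_le \<delta>_le] by (simp add: centres_def)
  then have "cball 0 (\<rho> 0) \<subseteq> balls"
    by (auto simp: balls_def)
  ultimately show ?thesis
    by (meson mem_interior_cball)
qed

lemma balls_subset_body: "balls \<subseteq> body"
  unfolding body_def by (meson closure_subset hull_subset subset_trans)

lemma polar_body: "polar body = polar balls"
  by (simp add: body_def polar_hull)

lemma normalized_mem_polar: "y \<in> E \<Longrightarrow> (1 / (N y \<bullet> y)) *\<^sub>R N y \<in> polar balls"
  using \<delta>_le[of y] \<delta>_pos balls_le[of _ y] by (intro polarI) (simp add: field_simps)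

sublocale nbhd: convex_nbhd body
proof
  show "closed body" "convex body"
    by (simp_all add: body_def convex_closure)
  show "0 \<in> interior body"
    using zero_interior_balls interior_mono[OF balls_subset_body] by blast
qed

text \<open>Radii and constraints depend only on projections to \<open>X\<close>, so
  \<open>balls\<close> is invariant under translations orthogonal to \<open>X\<close>.\<close>

lemma polar_balls_subset: "polar balls \<subseteq> X"
proof (rule polar_subset)
  show "0 \<in> balls"
    using zero_interior_balls interior_subset by blast
  fix x v assume "x \<in> balls" "P v = 0"
  then obtain a where a: "a \<in> centres" "dist a x \<le> \<rho> a"
    by (auto simp: balls_def)
  have P: "P (a + v) = P a"
    using \<open>P v = 0\<close> by (simp add: linear_add[OF linear_proj])
  then have "\<rho> (a + v) = \<rho> a"
    by (metis \<rho>_proj)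
  moreover have "N y \<bullet> (a + v) = N y \<bullet> a" if "y \<in> E" for y
    using inner_proj[OF N_mem[OF that], of v] \<open>P v = 0\<close> by (simp add: inner_add_right)
  ultimately have "a + v \<in> centres" "dist (a + v) (x + v) \<le> \<rho> (a + v)"
    using a by (auto simp: centres_def)
  then show "x + v \<in> balls"
    by (metis UN_I balls_def mem_cball)
qed

text \<open>Since \<open>balls\<close> may be unbounded, \<open>g\<close> need not a priori attain its supremum on it.
  Tilting \<open>g\<close> slightly towards a positive combination of values of \<open>N\<close> spanning \<open>X\<close>
  confines almost maximizers in \<open>X\<close> to a bounded set.\<close>

lemma polar_touches_ball:
  assumes p: "p \<in> body" and g: "g \<in> polar balls" and gp: "g \<bullet> p = 1"
  obtains a x where "a \<in> centres" "dist a x \<le> \<rho> a" "g \<bullet> x = 1"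
proof -
  \<comment> \<open>A basis of \<open>X\<close> made of values of \<open>N\<close>: each of its
    members is bounded above on \<open>balls\<close>.\<close>
  obtain B where B: "B \<subseteq> N ` E" "independent B" "N ` E \<subseteq> span B"
    using maximal_independent_subset[of "N ` E"] by blast
  have finB: "finite B"
    using B(2) independent_imp_finite by blast
  have spanB: "span B = X"
    unfolding span_N using B by (simp add: span_eq span_mono span_minimal order_trans[OF B(1) span_superset])
  define g0 where "g0 = \<Sum>B"
  have g0: "g0 \<in> X"
    unfolding g0_def spanB[symmetric] by (intro span_sum span_base)
  have gX: "g \<in> X"
    using g polar_balls_subset by blast
  define t :: "nat \<Rightarrow> real" where "t n = inverse (real (Suc n))" for n
  have t: "0 < t n" "t n \<le> 1" for n
    by (simp_all add: t_def divide_simps)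
  have t_lim: "t \<longlonglongrightarrow> 0"
    unfolding t_def by (rule LIMSEQ_inverse_real_of_nat)
  define h where "h n = (1 - t n) *\<^sub>R g + t n *\<^sub>R g0" for n
  have h: "h n \<in> X" for n
    unfolding h_def by (intro subspace_add subspace_scale subspace g0 gX)
  \<comment> \<open>The slack \<open>(t n)\<^sup>2\<close> is of smaller order than the tilt
    \<open>t n\<close>, so it stays bounded after division by \<open>t n\<close>.\<close>
  have "\<exists>a x. a \<in> centres \<and> dist a x \<le> \<rho> a \<and> x \<in> X \<and> h n \<bullet> p - (t n)\<^sup>2 \<le> h n \<bullet> x" for n
  proof -
    have "\<exists>x\<in>balls. h n \<bullet> p - (t n)\<^sup>2 \<le> h n \<bullet> x"
    proof (rule ccontr)
      assume "\<not> ?thesis"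
      then have "balls \<subseteq> {x. h n \<bullet> x \<le> h n \<bullet> p - (t n)\<^sup>2}"
        by auto
      then have "body \<subseteq> {x. h n \<bullet> x \<le> h n \<bullet> p - (t n)\<^sup>2}"
        unfolding body_def
        by (intro closure_minimal hull_minimal convex_halfspace_le closed_halfspace_le)
      then show False
        using p t(1)[of n] by (auto simp: subset_iff)
    qed
    then obtain a x where ax: "a \<in> centres" "dist a x \<le> \<rho> a" "h n \<bullet> p - (t n)\<^sup>2 \<le> h n \<bullet> x"
      by (auto simp: balls_def)
    \<comment> \<open>Projecting to \<open>X\<close> changes neither the radius nor the value of
      \<open>h n\<close>.\<close>
    have "dist (P a) (P x) \<le> \<rho> (P a)"
      using dist_proj_le[of a x] ax(2) by (simp add: \<rho>_proj)
    with ax show ?thesis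
      using proj_centres proj_mem inner_proj[OF h] by metis
  qed
  then obtain a x where ax: "\<And>n. a n \<in> centres" "\<And>n. dist (a n) (x n) \<le> \<rho> (a n)"
    "\<And>n. x n \<in> X" "\<And>n. h n \<bullet> p - (t n)\<^sup>2 \<le> h n \<bullet> x n"
    by metis
  have x_balls: "x n \<in> balls" for n
    using ax by (auto simp: balls_def)
  \<comment> \<open>On \<open>balls\<close> the functional \<open>g\<close> is at most its value 1
    at \<open>p\<close>, so near-maximality of \<open>x n\<close> must come from
    \<open>g0\<close>.\<close>
  have lower: "g0 \<bullet> p - 1 \<le> g0 \<bullet> x n" for n
  proof -
    have "(1 - t n) * (g \<bullet> x n) \<le> 1 - t n"
      using polarD[OF g x_balls, of n] t[of n] by (simp add: mult_left_le)
    then have "t n * (g0 \<bullet> p - t n) \<le> t n * (g0 \<bullet> x n)"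
      using ax(4)[of n] gp by (simp add: h_def inner_add_left algebra_simps power2_eq_square)
    then show ?thesis
      using t[of n] by simp
  qed
  have "\<forall>b\<in>B. \<exists>y. y \<in> E \<and> b = N y"
    using B(1) by blast
  then obtain y where y: "\<And>b. b \<in> B \<Longrightarrow> y b \<in> E \<and> b = N (y b)"
    by metis
  have "bounded (range x)"
  proof (rule coercive_bounded[OF finB])
    show "range x \<subseteq> span B"
      using ax(3) spanB by auto
    show "b \<bullet> z \<le> N (y b) \<bullet> y b" if "b \<in> B" "z \<in> range x" for b z
      using balls_le[of z "y b"] y[OF that(1)] that(2) x_balls by auto
    show "g0 \<bullet> p - 1 \<le> \<Sum>B \<bullet> z" if "z \<in> range x" for z
      using lower that by (auto simp: g0_def)
  qed
  then obtain b where b: "\<And>n. norm (x n) \<le> b"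
    by (auto simp: bounded_iff)
  have "norm (a n) \<le> b + \<delta>" for n
    using b[of n] ax(2)[of n] \<rho>_le[of "a n"] norm_triangle_ineq2[of "a n" "x n"]
    by (simp add: dist_norm)
  then have "bounded (range a)"
    by (auto simp: bounded_iff)
  then have "bounded (range a \<times> range x)"
    using \<open>bounded (range x)\<close> by (rule bounded_Times)
  then have "bounded (range (\<lambda>n. (a n, x n)))"
    by (rule bounded_subset) auto
  then obtain l s where s: "strict_mono s" "((\<lambda>n. (a n, x n)) \<circ> s) \<longlonglongrightarrow> l"
    using bounded_imp_convergent_subsequence by blast
  obtain a' x' where l: "l = (a', x')"
    by (cases l)
  have lims: "(\<lambda>n. a (s n)) \<longlonglongrightarrow> a'" "(\<lambda>n. x (s n)) \<longlonglongrightarrow> x'"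
    using tendsto_fst[OF s(2)] tendsto_snd[OF s(2)] by (simp_all add: l o_def)
  have ts: "(\<lambda>n. t (s n)) \<longlonglongrightarrow> 0"
    using LIMSEQ_subseq_LIMSEQ[OF t_lim s(1)] by (simp add: o_def)
  show thesis
  proof
    show "a' \<in> centres"
      using closed_sequentially[OF closed_centres _ lims(1)] ax(1) by blast
    have "(\<lambda>n. \<rho> (a (s n))) \<longlonglongrightarrow> \<rho> a'"
      using continuous_on_tendsto_compose[OF continuous_on_\<rho>[of UNIV] lims(1)] by simp
    then show "dist a' x' \<le> \<rho> a'"
      using tendsto_dist[OF lims] ax(2) by (blast intro: LIMSEQ_le)
    have hs: "(\<lambda>n. h (s n)) \<longlonglongrightarrow> (1 - 0) *\<^sub>R g + 0 *\<^sub>R g0"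
      unfolding h_def by (intro tendsto_intros ts)
    have "(1 - 0) *\<^sub>R g + 0 *\<^sub>R g0 = g"
      by simp
    with hs have hs: "(\<lambda>n. h (s n)) \<longlonglongrightarrow> g"
      by simp
    have "(\<lambda>n. h (s n) \<bullet> p - (t (s n))\<^sup>2) \<longlonglongrightarrow> g \<bullet> p - 0\<^sup>2"
      by (intro tendsto_intros hs ts)
    moreover have "(\<lambda>n. h (s n) \<bullet> x (s n)) \<longlonglongrightarrow> g \<bullet> x'"
      by (intro tendsto_intros hs lims)
    ultimately have "g \<bullet> p - 0\<^sup>2 \<le> g \<bullet> x'"
      using ax(4) by (blast intro: LIMSEQ_le)
    moreover have "(\<lambda>n. g \<bullet> x (s n)) \<longlonglongrightarrow> g \<bullet> x'"
      by (intro tendsto_intros lims)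
    then have "g \<bullet> x' \<le> 1"
      by (rule LIMSEQ_le_const2) (use polarD[OF g x_balls] in blast)
    ultimately show "g \<bullet> x' = 1"
      using gp by simp
  qed
qed

text \<open>If all small steps along \<open>h\<close> left \<open>centres\<close>, the violated
  constraints would have normals converging to \<open>\<nu>\<close> by (2). The radius is quadratic
  in the step length, so dividing by that length leaves \<open>\<nu> \<bullet> h \<ge> 0\<close> in
  the limit.\<close>

lemma tangent_centres:
  assumes a: "a \<in> centres" and \<rho>: "\<rho> a = 0"
  obtains \<nu> where "norm \<nu> = 1"
    "\<And>h. \<nu> \<bullet> h < 0 \<Longrightarrow> \<exists>s>0. a + s *\<^sub>R h \<in> centres"
proof -
  \<comment> \<open>As \<open>\<delta>\<close> is positive, a zero radius can only come from a zero
    distance.\<close>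
  have inf0: "infdist (P a) (P ` E) = 0"
    using \<rho> \<delta>_pos by (auto simp: \<rho>_def min_def split: if_splits)
  then have "P a \<in> closure (P ` E)"
    using nonempty by (simp add: in_closure_iff_infdist_zero)
  then obtain q where q: "\<And>n. q n \<in> P ` E" "q \<longlonglongrightarrow> P a"
    by (auto simp: closure_sequential)
  moreover have "\<forall>n. \<exists>y. y \<in> E \<and> q n = P y"
    using q(1) by blast
  ultimately obtain y0 where y0: "\<And>n. y0 n \<in> E" "\<And>n. q n = P (y0 n)"
    by metis
  \<comment> \<open>The direction \<open>\<nu>\<close> is a subsequential limit of the unit vectors
    \<open>N\<close> along points whose projections approach \<open>P a\<close>.\<close>
  have "bounded (range (\<lambda>n. N (y0 n)))"
    using norm_N y0 by (auto simp: bounded_iff intro!: exI[of _ 1])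
  then obtain \<nu> s where s: "strict_mono s" "((\<lambda>n. N (y0 n)) \<circ> s) \<longlonglongrightarrow> \<nu>"
    using bounded_imp_convergent_subsequence by blast
  define y where "y = y0 \<circ> s"
  have y: "y n \<in> E" for n
    using y0 by (simp add: y_def)
  have Py: "(\<lambda>n. P (y n)) \<longlonglongrightarrow> P a"
    using LIMSEQ_subseq_LIMSEQ[OF q(2) s(1)] y0 by (simp add: y_def o_def)
  have Ny: "(\<lambda>n. N (y n)) \<longlonglongrightarrow> \<nu>"
    using s(2) by (simp add: y_def o_def)
  have bdd: "bounded (range (\<lambda>n. P (y n)))"
    using Py convergent_imp_bounded by blast
  show thesis
  proof
    have "(\<lambda>n. norm (N (y n))) \<longlonglongrightarrow> norm \<nu>"
      by (intro tendsto_intros Ny)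
    then show "norm \<nu> = 1"
      using norm_N[OF y] by (simp add: LIMSEQ_const_iff)
    fix h assume h: "\<nu> \<bullet> h < 0"
    show "\<exists>s>0. a + s *\<^sub>R h \<in> centres"
    proof (rule ccontr)
      assume neg: "\<not> ?thesis"
      define t :: "nat \<Rightarrow> real" where "t n = inverse (real (Suc n))" for n
      have t: "t n > 0" for n
        by (simp add: t_def)
      have t_lim: "t \<longlonglongrightarrow> 0"
        unfolding t_def by (rule LIMSEQ_inverse_real_of_nat)
      have "\<exists>z\<in>E. N z \<bullet> z < N z \<bullet> (a + t n *\<^sub>R h) + \<rho> (a + t n *\<^sub>R h)" for n
        using neg t[of n] by (force simp: centres_def not_le)
      then obtain z where z: "\<And>n. z n \<in> E"
        "\<And>n. N (z n) \<bullet> z n < N (z n) \<bullet> (a + t n *\<^sub>R h) + \<rho> (a + t n *\<^sub>R h)"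
        by metis
      have \<rho>_small: "\<rho> (a + t n *\<^sub>R h) \<le> (t n)\<^sup>2 * (norm h)\<^sup>2" for n
      proof -
        have "infdist (P (a + t n *\<^sub>R h)) (P ` E) \<le> infdist (P a) (P ` E) + dist (P (a + t n *\<^sub>R h)) (P a)"
          by (rule infdist_triangle)
        also have "\<dots> \<le> t n * norm h"
          using inf0 dist_proj_le[of "a + t n *\<^sub>R h" a] t[of n] by (simp add: dist_norm)
        finally have "(infdist (P (a + t n *\<^sub>R h)) (P ` E))\<^sup>2 \<le> (t n * norm h)\<^sup>2"
          by (intro power_mono infdist_nonneg)
        then show ?thesis
          by (simp add: \<rho>_def power_mult_distrib min_le_iff_disj)
      qed
      \<comment> \<open>The violated constraint, with the radius replaced by its quadratic bound.
        The first summand is nonpositive, so it is squeezed to 0.\<close>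
      have ineq: "0 < N (z n) \<bullet> (a - z n) + t n * (N (z n) \<bullet> h) + (t n)\<^sup>2 * (norm h)\<^sup>2" for n
        using z(2)[of n] \<rho>_small[of n] by (simp add: inner_add_right inner_diff_right)
      have az: "N (z n) \<bullet> (a - z n) \<le> 0" for n
        using a z(1)[of n] \<rho> by (auto simp: centres_def inner_diff_right)
      have "\<bar>N (z n) \<bullet> (a - z n)\<bar> \<le> t n * norm h + (t n)\<^sup>2 * (norm h)\<^sup>2" for n
      proof -
        have "N (z n) \<bullet> h \<le> norm h"
          using norm_cauchy_schwarz[of "N (z n)" h] norm_N[OF z(1)] by simp
        then have "t n * (N (z n) \<bullet> h) \<le> t n * norm h"
          using t[of n] by simp
        then show ?thesis
          using ineq[of n] az[of n] by linarith
      qed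
      moreover have "(\<lambda>n. t n * norm h + (t n)\<^sup>2 * (norm h)\<^sup>2) \<longlonglongrightarrow> 0 * norm h + 0\<^sup>2 * (norm h)\<^sup>2"
        by (intro tendsto_intros t_lim)
      ultimately have lim1: "(\<lambda>n. N (z n) \<bullet> (a - z n)) \<longlonglongrightarrow> 0"
        by (intro Lim_null_comparison[of "\<lambda>n. N (z n) \<bullet> (a - z n)"
              "\<lambda>n. t n * norm h + (t n)\<^sup>2 * (norm h)\<^sup>2"] always_eventually) auto
      \<comment> \<open>This exchanges \<open>a\<close>, which need not lie in \<open>E\<close>, for
        \<open>y n\<close>, so that (2) becomes applicable.\<close>
      have lim2: "(\<lambda>n. N (z n) \<bullet> (P (y n) - P a)) \<longlonglongrightarrow> 0"
      proof (rule Lim_null_comparison)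
        show "\<forall>\<^sub>F n in sequentially. norm (N (z n) \<bullet> (P (y n) - P a)) \<le> norm (P (y n) - P a)"
          using Cauchy_Schwarz_ineq2[of "N (z n)" "P (y n) - P a" for n] norm_N[OF z(1)]
          by (intro always_eventually allI) (metis mult_1 real_norm_def)
        show "(\<lambda>n. norm (P (y n) - P a)) \<longlonglongrightarrow> 0"
          using Py by (simp add: LIM_zero tendsto_norm_zero)
      qed
      have "N (z n) \<bullet> (a - z n) + N (z n) \<bullet> (P (y n) - P a) = N (z n) \<bullet> (y n - z n)" for n
        by (simp add: inner_diff_right inner_proj N_mem z(1))
      then have "(\<lambda>n. N (z n) \<bullet> (y n - z n)) \<longlonglongrightarrow> 0"
        using tendsto_add[OF lim1 lim2] by simp
      then have "(\<lambda>n. norm (N (z n) - N (y n))) \<longlonglongrightarrow> 0"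
        using y z(1) by (intro separation bdd) auto
      then have "(\<lambda>n. N (z n) - N (y n)) \<longlonglongrightarrow> 0"
        by (simp add: tendsto_norm_zero_iff)
      from tendsto_add[OF this Ny] have Nz: "(\<lambda>n. N (z n)) \<longlonglongrightarrow> \<nu>"
        by simp
      \<comment> \<open>These terms are nonnegative: the nonpositive summand of \<open>ineq\<close>
        is dropped and the rest divided by \<open>t n\<close>.\<close>
      have "(\<lambda>n. N (z n) \<bullet> h + t n * (norm h)\<^sup>2) \<longlonglongrightarrow> \<nu> \<bullet> h + 0 * (norm h)\<^sup>2"
        by (intro tendsto_intros Nz t_lim)
      moreover have "0 \<le> N (z n) \<bullet> h + t n * (norm h)\<^sup>2" for n
      proof -
        have "0 < t n * (N (z n) \<bullet> h + t n * (norm h)\<^sup>2)"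
          using ineq[of n] az[of n] by (simp add: algebra_simps power2_eq_square)
        then show ?thesis
          using t[of n] by (simp add: zero_less_mult_iff)
      qed
      ultimately have "0 \<le> \<nu> \<bullet> h + 0 * (norm h)\<^sup>2"
        by (intro LIMSEQ_le_const) auto
      with h show False
        by simp
    qed
  qed
qed

text \<open>Separate contact points for \<open>g\<close> and \<open>h\<close> would not be
  comparable. The mean yields a common one: both values there are at most 1 and average to
  1.\<close>

lemma polar_unique:
  assumes p: "p \<in> body" and g: "g \<in> polar balls" "g \<bullet> p = 1" and h: "h \<in> polar balls" "h \<bullet> p = 1"
  shows "g = h"
proof -
  define k where "k = (1/2) *\<^sub>R g + (1/2) *\<^sub>R h"
  have "k \<in> polar balls"
    unfolding k_def by (rule convexD[OF convex_polar]) (use g h in auto)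
  moreover have "k \<bullet> p = 1"
    using g h by (simp add: k_def inner_add_left)
  ultimately obtain a x where a: "a \<in> centres" "dist a x \<le> \<rho> a" and kx: "k \<bullet> x = 1"
    using polar_touches_ball[OF p] by metis
  have ball: "y \<in> balls" if "dist a y \<le> \<rho> a" for y
    using a(1) that by (auto simp: balls_def)
  have gx: "g \<bullet> x = 1" and hx: "h \<bullet> x = 1"
    using polarD[OF g(1) ball[OF a(2)]] polarD[OF h(1) ball[OF a(2)]] kx
    by (auto simp: k_def inner_add_left)
  show ?thesis
  proof (cases "\<rho> a = 0")
    case True
    with a have "x = a"
      by simp
    obtain \<nu> where \<nu>: "norm \<nu> = 1" "\<And>h. \<nu> \<bullet> h < 0 \<Longrightarrow> \<exists>s>0. a + s *\<^sub>R h \<in> centres"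
      using tangent_centres[OF a(1) True] by metis
    \<comment> \<open>Steps into the half space reach centres, where \<open>f\<close> is at most its
      value 1 at \<open>a\<close>.\<close>
    have dir: "f = (f \<bullet> \<nu>) *\<^sub>R \<nu>" if "f \<in> polar balls" "f \<bullet> x = 1" for f
    proof (rule halfspace_direction[OF \<nu>(1)])
      fix v assume "\<nu> \<bullet> v < 0"
      then obtain s where "s > 0" "a + s *\<^sub>R v \<in> centres"
        using \<nu>(2) by blast
      moreover from this have "f \<bullet> (a + s *\<^sub>R v) \<le> 1"
        using that(1) centres_subset_balls by (blast intro: polarD)
      ultimately show "f \<bullet> v \<le> 0"
        using that(2) \<open>x = a\<close> by (simp add: inner_add_right mult_le_0_iff)
    qed
    from dir[OF g(1) gx] dir[OF h(1) hx] gx hx show ?thesis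
      by (rule scaled_eq)
  next
    case False
    then have r: "\<rho> a > 0"
      using \<rho>_nonneg[of a] by simp
    have dir: "f = (norm f / \<rho> a) *\<^sub>R (x - a)" if "f \<in> polar balls" "f \<bullet> x = 1" for f
      using that(2) polarD[OF that(1) ball] by (intro max_cball_direction[OF r a(2)]) simp
    from dir[OF g(1) gx] dir[OF h(1) hx] gx hx show ?thesis
      by (rule scaled_eq)
  qed
qed

section \<open>Verification of the required properties of the body\<close>

lemma body_C1: "class_C1 body"
proof (rule nbhd.class_C1I)
  fix x g h assume "x \<in> frontier body" "g \<in> polar body" "h \<in> polar body" "g \<bullet> x = 1" "h \<bullet> x = 1"
  moreover from this have "x \<in> body"
    using frontier_subset_closed nbhd.closed by blast
  ultimately show "g = h"
    using polar_unique[of x g h] by (simp add: polar_body)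
qed

lemma subset_frontier_body: "E \<subseteq> frontier body"
proof
  fix y assume y: "y \<in> E"
  show "y \<in> frontier body"
  proof (rule nbhd.frontierI)
    show "y \<in> body"
      using y subset_balls balls_subset_body by blast
    show "(1 / (N y \<bullet> y)) *\<^sub>R N y \<in> polar body"
      using normalized_mem_polar[OF y] by (simp add: polar_body)
    show "(1 / (N y \<bullet> y)) *\<^sub>R N y \<bullet> y = 1"
      using \<delta>_pos \<delta>_le[OF y] by simp
  qed
qed

text \<open>The rescaled \<open>N y\<close> supports the body at \<open>y\<close>, so by uniqueness
  it is the gradient; normalising recovers \<open>N y\<close>.\<close>

lemma outer_normal_body:
  assumes y: "y \<in> E" shows "outer_normal body y = N y"
proof -
  have pos: "N y \<bullet> y > 0"
    using \<delta>_pos \<delta>_le[OF y] by simp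
  have "gradient (minkowski_functional body) y = (1 / (N y \<bullet> y)) *\<^sub>R N y"
    using nbhd.class_C1_polar_unique[OF body_C1, of y "(1 / (N y \<bullet> y)) *\<^sub>R N y"]
      subset_frontier_body y normalized_mem_polar[OF y] pos by (auto simp: polar_body)
  then show ?thesis
    using pos norm_N[OF y] by (simp add: outer_normal_def)
qed

lemma span_normals_body: "X = span (outer_normal body ` frontier body)"
proof
  have "N ` E \<subseteq> outer_normal body ` frontier body"
    using outer_normal_body subset_frontier_body by (force simp: image_iff)
  then show "X \<subseteq> span (outer_normal body ` frontier body)"
    unfolding span_N by (rule span_mono)
  have "outer_normal body x \<in> X" if "x \<in> frontier body" for x
    using nbhd.class_C1_gradient(1)[OF body_C1 that] polar_balls_subset subspace
    by (auto simp: outer_normal_def polar_body intro: subspace_scale)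
  then show "span (outer_normal body ` frontier body) \<subseteq> X"
    using subspace by (intro span_minimal) auto
qed

end

theorem corollary1p17:
  fixes E X :: "(real ^ 'n) set"
    and N P :: "real ^ 'n \<Rightarrow> real ^ 'n"
  assumes "continuous_on E N"
    and "N ` E \<subseteq> sphere 0 1"
    and "subspace X"
    and "X = span (N ` E)"
    and "orthogonal_projection P X"
  shows
    "(\<exists>W. convex_body W \<and> 0 \<in> interior W \<and> class_C1 W \<and> E \<subseteq> frontier W \<and>
          (\<forall>x\<in>E. N x = outer_normal W x) \<and>
          X = span (outer_normal W ` frontier W))
     \<longleftrightarrow>
     (\<forall>x\<in>E. \<forall>y\<in>E. N y \<bullet> (x - y) \<le> 0) \<and>
     (\<forall>x z :: nat \<Rightarrow> real ^ 'n.
        range x \<subseteq> E \<longrightarrow> range z \<subseteq> E \<longrightarrow> bounded (range (\<lambda>k. P (x k))) \<longrightarrow>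
        (\<lambda>k. N (z k) \<bullet> (x k - z k)) \<longlonglongrightarrow> 0 \<longrightarrow>
        (\<lambda>k. norm (N (z k) - N (x k))) \<longlonglongrightarrow> 0) \<and>
     0 < (INF y\<in>E. ereal (N y \<bullet> y))"
    (is "(\<exists>W. ?body W) \<longleftrightarrow> ?mono \<and> ?sep \<and> ?inf")
proof
  assume "\<exists>W. ?body W"
  then obtain W where W: "?body W" ..
  then interpret C1_body W X P
    using assms by unfold_locales (auto simp: convex_body_def)
  have EW: "E \<subseteq> frontier W" and N: "\<And>x. x \<in> E \<Longrightarrow> N x = outer_normal W x"
    using W by auto
  have sub: "frontier W \<subseteq> W"
    using frontier_subset_closed closed by blast
  have ?mono
    using N EW sub outer_normal_le by (metis subsetD)
  moreover have ?sep
  proof (intro allI impI)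
    fix x z :: "nat \<Rightarrow> real ^ 'n"
    assume xz: "range x \<subseteq> E" "range z \<subseteq> E" and bdd: "bounded (range (\<lambda>k. P (x k)))"
      and lim: "(\<lambda>k. N (z k) \<bullet> (x k - z k)) \<longlonglongrightarrow> 0"
    then have E: "x k \<in> E" "z k \<in> E" for k
      by auto
    then show "(\<lambda>k. norm (N (z k) - N (x k))) \<longlonglongrightarrow> 0"
      using outer_normal_tendsto[of x z] EW N bdd lim by (simp add: subset_iff)
  qed
  moreover obtain r where r: "r > 0" "\<And>y. y \<in> frontier W \<Longrightarrow> r \<le> outer_normal W y \<bullet> y"
    using outer_normal_inner_ge by blast
  \<comment> \<open>In the extended reals this bound also covers empty \<open>E\<close>, where the
    infimum is infinite.\<close>
  have "ereal r \<le> (INF y\<in>E. ereal (N y \<bullet> y))"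
    using r(2) EW N by (intro INF_greatest) auto
  then have ?inf
    using r(1) by (metis ereal_less(2) less_le_trans)
  ultimately show "?mono \<and> ?sep \<and> ?inf"
    by blast
next
  assume cond: "?mono \<and> ?sep \<and> ?inf"
  show "\<exists>W. ?body W"
  proof (cases "E = {}")
    case True
    \<comment> \<open>Without points to interpolate, the whole space serves: its gauge vanishes
      identically, so the smoothness condition is vacuous, and its boundary is empty.\<close>
    have "minkowski_functional (UNIV :: (real ^ 'n) set) x = 0" for x
    proof -
      interpret convex_nbhd "UNIV :: (real ^ 'n) set"
        by unfold_locales auto
      have "minkowski_functional UNIV x \<le> 0"
        by (rule dense_ge) (auto intro: gauge_le)
      then show ?thesis
        using gauge_nonneg[of x] by linarith
    qed
    then have "UNIV - minkowski_functional (UNIV :: (real ^ 'n) set) -` {0} = {}"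
      by auto
    then have "class_C1 (UNIV :: (real ^ 'n) set)"
      unfolding class_C1_def C1_on_def by (simp only:) simp
    then have "?body UNIV"
      using True assms(4) by (simp add: convex_body_def)
    then show ?thesis ..
  next
    case False
    \<comment> \<open>A real number strictly below the infimum gives the uniform bound without
      converting the infimum itself to a real.\<close>
    obtain \<delta> where \<delta>: "0 < ereal \<delta>" "ereal \<delta> < (INF y\<in>E. ereal (N y \<bullet> y))"
      using cond ereal_dense2 by blast
    have "\<delta> \<le> N y \<bullet> y" if "y \<in> E" for y
      using order_trans[OF less_imp_le[OF \<delta>(2)] INF_lower[OF that]] by simp
    then interpret normal_field P X E N \<delta>
      using cond assms False \<delta>(1) by unfold_locales auto
    have "?body body"
      using nbhd.closed nbhd.convex nbhd.zero_interior body_C1 subset_frontier_body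
        outer_normal_body span_normals_body by (auto simp: convex_body_def)
    then show ?thesis ..
  qed
qed

end
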